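(* Let $p:\mathbb{R}\to\mathbb{R}$ be a real function that is periodic with period $T$, i.e. $p(t+T)=p(t)$, and let $t\ge0$. Consider the two-state continuous time Markov chain on $\{-1,+1\}$ with both jump rates (from $-1$ to $+1$ and from $+1$ to $-1$) equal to $p$, whose state probabilities are $$\nu_-(t)=\frac{1}{2}-\frac{\nu_+(0)-\nu_-(0)}{2}\exp\left\{-2\int_0^tp(s)\,ds\right\},\qquad \nu_+(t)=\frac{1}{2}+\frac{\nu_+(0)-\nu_-(0)}{2}\exp\left\{-2\int_0^tp(s)\,ds\right\}.$$ For these state probabilities the invariant measures are $$\overline{\nu}(t)=\frac12\begin{pmatrix}1\\1\end{pmatrix}.$$
   Context: The process $Y_t\in\{-1,+1\}$ has probability $p(t)\,\delta t$ of jumping (in either direction) in a small time interval $[t,t+\delta t]$. Its state probabilities are $\nu_-(t)=P(Y_t=-1)$ and $\nu_+(t)=P(Y_t=+1)$, with $\nu_-(t)+\nu_+(t)=1$ and initial values $\nu_-(0),\nu_+(0)$; they solve $\nu_-'=p(\nu_+-\nu_-)$, $\nu_+'=p(\nu_--\nu_+)$. Write $\nu(t)$ for the column vector with entries $\nu_-(t),\nu_+(t)$. The invariant measure $\overline{\nu}(t)$, with entries $\overline{\nu}_-(t),\overline{\nu}_+(t)$, is the limit of the state probabilities over an integer number $N$ of periods, $\overline{\nu}(t)=\lim_{N\to\infty}\nu(NT+t)$.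
   Formalization: The formal theorem also assumes that p is integrable over a period with strictly positive integral; without positivity the claim fails (p = 0 leaves ν(t) = ν(0) for all t). The displayed state probabilities are derived from the jump rates, not assumed. *)

theory Defs
  imports "HOL-Probability.Probability"
begin

text \<open>
  A two-state continuous time Markov chain on \<open>{-1, 1}\<close>, indexed by \<open>t \<ge> 0\<close>, whose jump rate is
  \<open>p t\<close> in both directions.

  The rate conditions express that, given the state \<open>y\<close>, the probability of jumping in a time
  interval of length \<open>h\<close> adjacent to \<open>t\<close> is \<open>p t * h + o(h)\<close>. They are stated through joint
  probabilities, so that they make sense when the state \<open>y\<close> has probability 0 (for instance at
  time 0 for a deterministic initial state). Intervals \<open>[t - h, t]\<close> are needed besides
  \<open>[t, t + h]\<close>: limits from the right alone do not exclude a jump at a deterministic time.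

  The rate may fail to exist at countably many times, so that discontinuous rates (such as square
  waves) are admitted; at such times only continuity in probability is required.
\<close>

locale two_state_chain = prob_space M
  for M :: "'a measure" +
  fixes Y :: "real \<Rightarrow> 'a \<Rightarrow> int" and p :: "real \<Rightarrow> real"
  assumes state: "\<And>t. 0 \<le> t \<Longrightarrow> Y t \<in> measurable M (count_space {-1, 1})"
    and markov: "\<And>s u J c y. 0 \<le> s \<Longrightarrow> s \<le> u \<Longrightarrow> finite J \<Longrightarrow> J \<subseteq> {0..<s} \<Longrightarrow>
      \<P>(\<omega> in M. Y s \<omega> = c s \<and> (\<forall>r\<in>J. Y r \<omega> = c r)) > 0 \<Longrightarrow>
      \<P>(\<omega> in M. Y u \<omega> = y \<bar> Y s \<omega> = c s \<and> (\<forall>r\<in>J. Y r \<omega> = c r))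
        = \<P>(\<omega> in M. Y u \<omega> = y \<bar> Y s \<omega> = c s)"
    and continuous_in_prob: "\<And>t. 0 \<le> t \<Longrightarrow>
      ((\<lambda>s. \<P>(\<omega> in M. Y s \<omega> \<noteq> Y t \<omega>)) \<longlongrightarrow> 0) (at t within {0..})"
    and jump_rate: "\<exists>C. countable C \<and> (\<forall>t\<in>{0..} - C. \<forall>y\<in>{-1, 1}.
      ((\<lambda>h. \<P>(\<omega> in M. Y t \<omega> = y \<and> Y (t + h) \<omega> = - y) / h)
          \<longlongrightarrow> p t * \<P>(\<omega> in M. Y t \<omega> = y)) (at_right 0) \<and>
      (0 < t \<longrightarrow>
        ((\<lambda>h. \<P>(\<omega> in M. Y (t - h) \<omega> = y \<and> Y t \<omega> = - y) / h)
          \<longlongrightarrow> p t * \<P>(\<omega> in M. Y t \<omega> = y)) (at_right 0)))"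

definition state_prob :: "'a measure \<Rightarrow> (real \<Rightarrow> 'a \<Rightarrow> int) \<Rightarrow> int \<Rightarrow> real \<Rightarrow> real" where
  "state_prob M Y y t = \<P>(\<omega> in M. Y t \<omega> = y)"

definition state_vec :: "'a measure \<Rightarrow> (real \<Rightarrow> 'a \<Rightarrow> int) \<Rightarrow> real \<Rightarrow> real ^ 2" where
  "state_vec M Y t = vector [state_prob M Y (-1) t, state_prob M Y 1 t]"

text \<open>
  The value of \<open>lim\<close> is meaningful only if the sequence converges; convergence is therefore to be
  claimed separately.
\<close>

definition invariant_measure ::
    "'a measure \<Rightarrow> (real \<Rightarrow> 'a \<Rightarrow> int) \<Rightarrow> real \<Rightarrow> real \<Rightarrow> real ^ 2" where
  "invariant_measure M Y T t = lim (\<lambda>N. state_vec M Y (real N * T + t))"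

end

theory Submission
  imports Defs
begin

text \<open>
  Let \<open>d t = P(Y t = 1) - P(Y t = -1)\<close>. Balancing the jumps out of and into each state, the rate
  conditions give \<open>d' t = -2 * p t * d t\<close> at every \<open>t > 0\<close> outside a countable set, and continuity in
  probability makes \<open>d\<close> continuous. The claim is that these two facts force
  \<open>d t = d 0 * exp (-2 * \<integral>{0..t} p)\<close>; since the two state probabilities sum to 1, both formulas
  follow. Over each period the exponent decreases by the same positive amount
  \<open>2 * \<integral>{0..T} p\<close>, so \<open>d (N * T + t)\<close> tends to 0 and both state probabilities tend to \<open>1/2\<close>.

  The delicate point is the solution of the differential equation. The rate is an arbitrary
  integrable function, so its indefinite integral need be differentiable only almost
  everywhere, and continuity together with an almost everywhere vanishing derivative does not force
  \<open>d t * exp (2 * \<integral>{0..t} p)\<close> to be constant. Instead, as long as \<open>d\<close> has no zero, \<open>ln \<bar>d\<bar>\<close> is a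
  continuous function with derivative \<open>-2 * p\<close> outside a \<^emph>\<open>countable\<close> set, and the fundamental theorem of
  calculus in the form \<open>fundamental_theorem_of_calculus_countable\<close> applies to it. So the product is
  locally constant wherever it is not 0, and by continuity and connectedness it is constant
  (\<open>linear_ode_solution\<close>).
\<close>

section \<open>The fundamental theorem of calculus with countably many exceptional points\<close>

text \<open>
  The function puts half of its jump at \<open>c \<in> C\<close> to the left and half to the right of \<open>c\<close>. Hence it
  increases by at least \<open>w c\<close> over every nondegenerate interval that contains \<open>c\<close>, even if \<open>c\<close> is
  an endpoint. In a Riemann sum it pays for all intervals tagged by points of \<open>C\<close>, so that there is
  no need to count how often each point occurs as a tag.
\<close>

lemma countable_set_jump_function:
  fixes C :: "real set"
  assumes "countable C"
  obtains \<psi> w :: "real \<Rightarrow> real"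
  where "mono \<psi>" "\<And>c. c \<in> C \<Longrightarrow> 0 < w c"
    "\<And>c u v. c \<in> C \<Longrightarrow> u \<le> c \<Longrightarrow> c \<le> v \<Longrightarrow> u < v \<Longrightarrow> w c \<le> \<psi> v - \<psi> u"
proof -
  \<comment> \<open>The point 0 only ensures that there is something to enumerate.\<close>
  define D where "D = insert 0 C"
  have "countable D" "D \<noteq> {}" using assms by (auto simp: D_def)
  define e where "e = from_nat_into D"
  define g :: "nat \<Rightarrow> real \<Rightarrow> real" where
    "g n u = (1/2) ^ n * (of_bool (e n < u) + of_bool (e n \<le> u))" for n u
  define \<psi> where "\<psi> u = (\<Sum>n. g n u)" for u
  have g_mono: "g n u \<le> g n v" if "u \<le> v" for n u v
    using that by (auto simp: g_def)
  have g_summable: "summable (\<lambda>n. g n u)" for u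
  proof (rule summable_comparison_test')
    show "summable (\<lambda>n. 2 * (1/2::real) ^ n)"
      by (intro summable_mult summable_geometric) simp
    show "norm (g n u) \<le> 2 * (1/2) ^ n" if "n \<ge> 0" for n
      by (auto simp: g_def)
  qed
  have term_le: "g n v - g n u \<le> \<psi> v - \<psi> u" if "u \<le> v" for n u v
  proof -
    have "(\<Sum>k\<in>{n}. g k v - g k u) \<le> (\<Sum>k. g k v - g k u)"
      using g_mono[OF that] by (intro sum_le_suminf summable_diff g_summable) auto
    also have "\<dots> = \<psi> v - \<psi> u"
      unfolding \<psi>_def by (rule suminf_diff[symmetric]) (rule g_summable)+
    finally show ?thesis by simp
  qed
  show thesis
  proof
    show "mono \<psi>"
    proof (rule monoI)
      fix u v :: real assume "u \<le> v"
      then show "\<psi> u \<le> \<psi> v" using term_le[of u v 0] g_mono[of u v 0] by linarith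
    qed
    show "0 < (1/2::real) ^ to_nat_on D c" for c by simp
    show "(1/2) ^ to_nat_on D c \<le> \<psi> v - \<psi> u" if "c \<in> C" "u \<le> c" "c \<le> v" "u < v" for c u v
    proof -
      have "e (to_nat_on D c) = c"
        using \<open>countable D\<close> \<open>c \<in> C\<close> by (simp add: e_def D_def)
      then have "(1/2) ^ to_nat_on D c \<le> g (to_nat_on D c) v - g (to_nat_on D c) u"
        using that by (auto simp: g_def)
      also have "\<dots> \<le> \<psi> v - \<psi> u" using that by (intro term_le) simp
      finally show ?thesis .
    qed
  qed
qed

text \<open>
  As in the classical proof, the gauge makes the error over an interval with tag \<open>x\<close> small. At
  \<open>x \<notin> C\<close> differentiability bounds it by a multiple of the length of the interval; at \<open>x \<in> C\<close>
  continuity bounds it by a multiple of \<open>w x\<close>, hence of the increment of \<open>\<psi>\<close>. Both are bounded by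
  the increment of \<open>u + \<psi> u\<close>, and these increments telescope.
\<close>

theorem fundamental_theorem_of_calculus_countable:
  fixes f f' :: "real \<Rightarrow> real"
  assumes "countable C" "a \<le> b" "continuous_on {a..b} f"
    and deriv: "\<And>x. x \<in> {a..b} - C \<Longrightarrow> (f has_real_derivative f' x) (at x within {a..b})"
  shows "(f' has_integral (f b - f a)) {a..b}"
proof -
  obtain \<psi> w :: "real \<Rightarrow> real" where "mono \<psi>" and w_pos: "\<And>c. c \<in> C \<Longrightarrow> 0 < w c"
    and w_le: "\<And>c u v. c \<in> C \<Longrightarrow> u \<le> c \<Longrightarrow> c \<le> v \<Longrightarrow> u < v \<Longrightarrow> w c \<le> \<psi> v - \<psi> u"
    using countable_set_jump_function[OF \<open>countable C\<close>] by blast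
  define G where "G u = u + \<psi> u" for u
  have G_le: "G u \<le> G v" if "u \<le> v" for u v
    using that monoD[OF \<open>mono \<psi>\<close> that] by (simp add: G_def)
  have local: "\<exists>d>0. \<forall>u v. a \<le> u \<and> u \<le> x \<and> x \<le> v \<and> v \<le> b \<and> \<bar>u - x\<bar> < d \<and> \<bar>v - x\<bar> < d \<longrightarrow>
      \<bar>(v - u) * f' x - (f v - f u)\<bar> \<le> e * (G v - G u)" if "0 < e" "x \<in> {a..b}" for e x
  proof (cases "x \<in> C")
    case False
    then have "(f has_derivative (\<lambda>h. f' x * h)) (at x within {a..b})"
      using deriv that by (simp add: has_field_derivative_def)
    with \<open>0 < e\<close> obtain d where d: "0 < d"
      "\<And>y. y \<in> {a..b} \<Longrightarrow> \<bar>y - x\<bar> < d \<Longrightarrow> \<bar>f y - f x - f' x * (y - x)\<bar> \<le> e * \<bar>y - x\<bar>"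
      unfolding has_derivative_within_alt real_norm_def by meson
    have "\<bar>(v - u) * f' x - (f v - f u)\<bar> \<le> e * (G v - G u)"
      if uv: "a \<le> u" "u \<le> x" "x \<le> v" "v \<le> b" "\<bar>u - x\<bar> < d" "\<bar>v - x\<bar> < d" for u v
    proof -
      have "\<bar>(v - u) * f' x - (f v - f u)\<bar> =
          \<bar>(f u - f x - f' x * (u - x)) - (f v - f x - f' x * (v - x))\<bar>"
        by (rule arg_cong[where f = abs]) (simp add: algebra_simps)
      also have "\<dots> \<le> e * \<bar>u - x\<bar> + e * \<bar>v - x\<bar>"
      proof -
        have "\<bar>f u - f x - f' x * (u - x)\<bar> \<le> e * \<bar>u - x\<bar>"
          "\<bar>f v - f x - f' x * (v - x)\<bar> \<le> e * \<bar>v - x\<bar>"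
          using uv by (intro d(2); simp)+
        then show ?thesis by linarith
      qed
      also have "\<dots> = e * (v - u)" using uv by (simp add: algebra_simps)
      also have "\<dots> \<le> e * (G v - G u)"
        using uv \<open>0 < e\<close> monoD[OF \<open>mono \<psi>\<close>, of u v] by (intro mult_left_mono) (auto simp: G_def)
      finally show ?thesis .
    qed
    with \<open>0 < d\<close> show ?thesis by blast
  next
    case True
    \<comment> \<open>The error splits into four terms: the variation of \<open>f\<close> and of \<open>f' x * y\<close> on each side of \<open>x\<close>.\<close>
    define \<eta> where "\<eta> = e * w x / 4"
    have "0 < \<eta>" using \<open>0 < e\<close> w_pos[OF True] by (simp add: \<eta>_def)
    obtain d where d: "0 < d" "\<And>y. y \<in> {a..b} \<Longrightarrow> \<bar>y - x\<bar> < d \<Longrightarrow> \<bar>f y - f x\<bar> < \<eta>"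
      using \<open>continuous_on {a..b} f\<close> \<open>x \<in> {a..b}\<close> \<open>0 < \<eta>\<close>
      unfolding continuous_on_iff dist_real_def by metis
    define d' where "d' = min d (\<eta> / (\<bar>f' x\<bar> + 1))"
    have "0 < d'" using d \<open>0 < \<eta>\<close> by (simp add: d'_def)
    have near: "\<bar>y - x\<bar> * \<bar>f' x\<bar> \<le> \<eta>" if "\<bar>y - x\<bar> < d'" for y
    proof -
      have "\<bar>y - x\<bar> * \<bar>f' x\<bar> \<le> \<bar>y - x\<bar> * (\<bar>f' x\<bar> + 1)" by (intro mult_left_mono) auto
      also have "\<dots> \<le> \<eta> / (\<bar>f' x\<bar> + 1) * (\<bar>f' x\<bar> + 1)"
        using that by (intro mult_right_mono) (auto simp: d'_def)
      also have "\<dots> = \<eta>"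
      proof -
        have "\<bar>f' x\<bar> + 1 \<noteq> 0" by linarith
        then show ?thesis by simp
      qed
      finally show ?thesis .
    qed
    have "\<bar>(v - u) * f' x - (f v - f u)\<bar> \<le> e * (G v - G u)"
      if uv: "a \<le> u" "u \<le> x" "x \<le> v" "v \<le> b" "\<bar>u - x\<bar> < d'" "\<bar>v - x\<bar> < d'" for u v
    proof (cases "u < v")
      case True
      have "(v - u) * f' x - (f v - f u) = (v - x) * f' x - (u - x) * f' x - (f v - f x) + (f u - f x)"
        by (simp add: algebra_simps)
      moreover have "\<bar>(v - x) * f' x\<bar> \<le> \<eta>" "\<bar>(u - x) * f' x\<bar> \<le> \<eta>"
        using near[OF uv(6)] near[OF uv(5)] by (simp_all only: abs_mult)
      moreover have "\<bar>f v - f x\<bar> < \<eta>" "\<bar>f u - f x\<bar> < \<eta>"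
        using d(2) uv by (auto simp: d'_def)
      ultimately have "\<bar>(v - u) * f' x - (f v - f u)\<bar> \<le> 4 * \<eta>"
        by linarith
      also have "\<dots> = e * w x" by (simp add: \<eta>_def)
      also have "\<dots> \<le> e * (G v - G u)"
        using w_le[OF \<open>x \<in> C\<close> \<open>u \<le> x\<close> \<open>x \<le> v\<close> True] True \<open>0 < e\<close>
        by (intro mult_left_mono) (auto simp: G_def)
      finally show ?thesis .
    next
      case False
      then have "u = v" using uv by linarith
      then show ?thesis by simp
    qed
    with \<open>0 < d'\<close> show ?thesis by blast
  qed
  show ?thesis
    unfolding has_integral_real
  proof (intro allI impI)
    fix e :: real assume "0 < e"
    define \<epsilon> where "\<epsilon> = e / (G b - G a + 1)"
    have "0 < \<epsilon>" using \<open>0 < e\<close> G_le[OF \<open>a \<le> b\<close>] by (simp add: \<epsilon>_def)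
    have small: "\<epsilon> * (G b - G a) < e"
      using \<open>0 < e\<close> G_le[OF \<open>a \<le> b\<close>] by (simp add: \<epsilon>_def field_simps)
    have "\<forall>x. \<exists>d>0. x \<in> {a..b} \<longrightarrow>
        (\<forall>u v. a \<le> u \<and> u \<le> x \<and> x \<le> v \<and> v \<le> b \<and> \<bar>u - x\<bar> < d \<and> \<bar>v - x\<bar> < d \<longrightarrow>
          \<bar>(v - u) * f' x - (f v - f u)\<bar> \<le> \<epsilon> * (G v - G u))"
      using local[OF \<open>0 < \<epsilon>\<close>] zero_less_one by blast
    then obtain d where d: "\<And>x. 0 < d x"
      "\<And>x u v. x \<in> {a..b} \<Longrightarrow> a \<le> u \<Longrightarrow> u \<le> x \<Longrightarrow> x \<le> v \<Longrightarrow> v \<le> b \<Longrightarrow> \<bar>u - x\<bar> < d x \<Longrightarrow>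
        \<bar>v - x\<bar> < d x \<Longrightarrow> \<bar>(v - u) * f' x - (f v - f u)\<bar> \<le> \<epsilon> * (G v - G u)"
      by metis
    have "norm ((\<Sum>(x, K)\<in>\<D>. measure lborel K *\<^sub>R f' x) - (f b - f a)) < e"
      if tag: "\<D> tagged_division_of {a..b}" and fine: "(\<lambda>x. ball x (d x)) fine \<D>" for \<D>
    proof -
      have "(\<Sum>(x, K)\<in>\<D>. measure lborel K *\<^sub>R f' x) - (f b - f a) =
          (\<Sum>(x, K)\<in>\<D>. measure lborel K *\<^sub>R f' x - (f (Sup K) - f (Inf K)))"
        by (simp add: additive_tagged_division_1[OF \<open>a \<le> b\<close> tag, of f, symmetric]
            sum_subtractf split_def)
      also have "norm \<dots> \<le> (\<Sum>(x, K)\<in>\<D>. \<epsilon> * (G (Sup K) - G (Inf K)))"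
      proof (rule sum_norm_le, clarify)
        fix x K assume xK: "(x, K) \<in> \<D>"
        obtain u v where K: "K = {u..v}"
          using tagged_division_ofD(4)[OF tag xK] by auto
        have "x \<in> K" "K \<subseteq> {a..b}"
          using tagged_division_ofD(2,3)[OF tag xK] by auto
        with K have uv: "u \<le> x" "x \<le> v" "a \<le> u" "v \<le> b" by auto
        have "K \<subseteq> ball x (d x)" using fineD[OF fine xK] .
        moreover have "u \<in> K" "v \<in> K" using K uv by auto
        ultimately have "u \<in> ball x (d x)" "v \<in> ball x (d x)" by blast+
        then have "\<bar>u - x\<bar> < d x" "\<bar>v - x\<bar> < d x" by (auto simp: dist_real_def)
        then have "\<bar>(v - u) * f' x - (f v - f u)\<bar> \<le> \<epsilon> * (G v - G u)"
          using d(2)[of x u v] uv by simp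
        then show "norm (measure lborel K *\<^sub>R f' x - (f (Sup K) - f (Inf K))) \<le> \<epsilon> * (G (Sup K) - G (Inf K))"
          using K uv by simp
      qed
      also have "\<dots> = \<epsilon> * (G b - G a)"
        by (simp add: additive_tagged_division_1[OF \<open>a \<le> b\<close> tag, of G, symmetric]
            sum_distrib_left split_def)
      finally show ?thesis using small by simp
    qed
    moreover have "gauge (\<lambda>x. ball x (d x))"
      using d(1) by (intro gauge_ball_dependent) auto
    ultimately show "\<exists>\<gamma>. gauge \<gamma> \<and> (\<forall>\<D>. \<D> tagged_division_of {a..b} \<and> \<gamma> fine \<D> \<longrightarrow>
        norm ((\<Sum>(x, K)\<in>\<D>. measure lborel K *\<^sub>R f' x) - (f b - f a)) < e)"
      by blast
  qed
qed

section \<open>Homogeneous linear differential equations with integrable coefficient\<close>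

text \<open>
  The logarithm of \<open>x\<close> can be taken only away from the zeros of \<open>x\<close>. Where \<open>x c \<noteq> 0\<close>, it shows that
  \<open>x u * exp (- \<integral>{a..u} q)\<close> is constant near \<open>c\<close>; so the set where this product takes its value at
  \<open>c\<close> is open, and it is closed by continuity.
\<close>

theorem linear_ode_solution:
  fixes x q :: "real \<Rightarrow> real"
  assumes "countable C" "a \<le> b" and cont: "continuous_on {a..b} x"
    and deriv: "\<And>t. t \<in> {a<..<b} - C \<Longrightarrow> (x has_real_derivative q t * x t) (at t)"
    and q_int: "q integrable_on {a..b}"
  shows "x b = x a * exp (integral {a..b} q)"
proof -
  define Q where "Q u = integral {a..u} q" for u
  define g where "g u = x u * exp (- Q u)" for u
  have g_cont: "continuous_on {a..b} g"
    unfolding g_def Q_def by (intro continuous_intros cont indefinite_integral_continuous_1 q_int)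
  have same_sign: "g v = g u"
    if uv: "a \<le> u" "u \<le> v" "v \<le> b" and pos: "\<And>s. s \<in> {u..v} \<Longrightarrow> 0 < x s / k" for u v k
  proof -
    have "k \<noteq> 0" using pos[of u] uv by auto
    have "(q has_integral (ln (x v / k) - ln (x u / k))) {u..v}"
    proof (rule fundamental_theorem_of_calculus_countable)
      show "countable (C \<union> {u, v})" using \<open>countable C\<close> by simp
      show "continuous_on {u..v} (\<lambda>s. ln (x s / k))"
        using pos uv \<open>k \<noteq> 0\<close>
        by (intro continuous_intros continuous_on_subset[OF cont]) force+
      fix s assume s: "s \<in> {u..v} - (C \<union> {u, v})"
      then have "x s \<noteq> 0" using pos[of s] by auto
      have "(x has_real_derivative q s * x s) (at s)"
        using s uv by (intro deriv) auto
      then have "((\<lambda>s. ln (x s / k)) has_real_derivative q s) (at s)"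
        using \<open>k \<noteq> 0\<close> \<open>x s \<noteq> 0\<close> s pos[of s]
        by (auto intro!: derivative_eq_intros)
      then show "((\<lambda>s. ln (x s / k)) has_real_derivative q s) (at s within {u..v})"
        by (rule has_field_derivative_at_within)
    qed (use uv in auto)
    then have "integral {u..v} q = ln (x v / k) - ln (x u / k)"
      by (rule integral_unique)
    moreover have "Q u + integral {u..v} q = Q v"
      unfolding Q_def using uv
      by (intro Henstock_Kurzweil_Integration.integral_combine integrable_on_subinterval[OF q_int]) auto
    ultimately have "ln (x v / k) - Q v = ln (x u / k) - Q u" by linarith
    then have "exp (ln (x v / k)) * exp (- Q v) = exp (ln (x u / k)) * exp (- Q u)"
      by (simp flip: exp_add)
    then show ?thesis
      using pos[of u] pos[of v] uv \<open>k \<noteq> 0\<close> by (simp add: g_def)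
  qed
  have locally_const: "\<exists>e>0. \<forall>u\<in>{a..b}. dist u c < e \<longrightarrow> g u = g c"
    if c: "c \<in> {a..b}" "x c \<noteq> 0" for c
  proof -
    have "0 < \<bar>x c\<bar>" using c by simp
    then obtain e where e: "0 < e" "\<And>u. u \<in> {a..b} \<Longrightarrow> dist u c < e \<Longrightarrow> \<bar>x u - x c\<bar> < \<bar>x c\<bar>"
      using cont c(1) unfolding continuous_on_iff dist_real_def by metis
    have pos: "0 < x s / x c" if "s \<in> {a..b}" "dist s c < e" for s
      using e(2)[OF that] by (auto simp: zero_less_divide_iff abs_if split: if_splits)
    have "g u = g c" if u: "u \<in> {a..b}" "dist u c < e" for u
    proof (cases "u \<le> c")
      case True
      then have "g c = g u"
        using u c by (intro same_sign[of u c "x c"] pos) (auto simp: dist_real_def)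
      then show ?thesis by simp
    next
      case False
      then show ?thesis
        using u c by (intro same_sign[of c u "x c"] pos) (auto simp: dist_real_def)
    qed
    with e(1) show ?thesis by blast
  qed
  have "g b = g a"
  proof (cases "\<exists>c\<in>{a..b}. g c \<noteq> 0")
    case True
    then obtain c where c: "c \<in> {a..b}" "g c \<noteq> 0" by blast
    define S where "S = {u \<in> {a..b}. g u = g c}"
    have "closedin (top_of_set {a..b}) S"
      unfolding S_def by (rule continuous_closedin_preimage_constant[OF g_cont])
    moreover have "openin (top_of_set {a..b}) S"
      unfolding openin_euclidean_subtopology_iff
    proof (intro conjI ballI)
      show "S \<subseteq> {a..b}" by (auto simp: S_def)
      fix s assume s: "s \<in> S"
      then have "x s \<noteq> 0" using c by (auto simp: S_def g_def)
      then show "\<exists>e>0. \<forall>u\<in>{a..b}. dist u s < e \<longrightarrow> u \<in> S"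
        using locally_const[of s] s by (auto simp: S_def)
    qed
    moreover have "S \<noteq> {}" using c by (auto simp: S_def)
    ultimately have "S = {a..b}"
      using connected_clopen[of "{a..b}"] connected_Icc[of a b] by blast
    then have "a \<in> S" "b \<in> S" using \<open>a \<le> b\<close> by auto
    then show ?thesis by (simp add: S_def)
  next
    case False
    then show ?thesis using \<open>a \<le> b\<close> by auto
  qed
  then have "x b * exp (- Q b) = x a" by (simp add: g_def Q_def)
  then have "x b * (exp (- Q b) * exp (Q b)) = x a * exp (Q b)"
    by (metis mult.assoc)
  then show ?thesis by (simp add: Q_def flip: exp_add)
qed

section \<open>Integrals of periodic functions\<close>

lemma periodic_has_integral_shift:
  fixes p :: "real \<Rightarrow> real"
  assumes "\<And>s. p (s + T) = p s" "(p has_integral I) {a..b}"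
  shows "(p has_integral I) {a + T..b + T}"
proof -
  have "p \<circ> (+) T = p" using assms(1) by (auto simp: add.commute)
  then show ?thesis using assms(2) has_integral_shift_Icc_real[of p T I a b] by simp
qed

lemma periodic_integrable:
  fixes p :: "real \<Rightarrow> real"
  assumes "0 < T" and per: "\<And>s. p (s + T) = p s" and int: "p integrable_on {0..T}"
  shows "p integrable_on {0..b}"
proof -
  have periods: "p integrable_on {0..real n * T}" for n
  proof (induction n)
    case (Suc n)
    from Suc.IH have "p integrable_on {0 + T..real n * T + T}"
      using periodic_has_integral_shift[where p = p and T = T, OF per] by (meson integrable_on_def)
    moreover have "real n * T + T = real (Suc n) * T" by (simp add: algebra_simps)
    ultimately show ?case
      using \<open>0 < T\<close> int
      by (intro Henstock_Kurzweil_Integration.integrable_combine[of 0 T "real (Suc n) * T"]) auto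
  qed (use integrable_on_refl[of p 0] in simp)
  obtain n where "b / T < real n" using reals_Archimedean2 by blast
  then have "{0..b} \<subseteq> {0..real n * T}" using \<open>0 < T\<close> by (auto simp: field_simps)
  then show ?thesis using integrable_on_subinterval[OF periods[of n]] by blast
qed

lemma periodic_integral_add_periods:
  fixes p :: "real \<Rightarrow> real"
  assumes "0 < T" and per: "\<And>s. p (s + T) = p s" and int: "p integrable_on {0..T}" and "0 \<le> t"
  shows "integral {0..real N * T + t} p = real N * integral {0..T} p + integral {0..t} p"
proof (induction N)
  case (Suc N)
  define s where "s = real N * T + t"
  have "0 \<le> s" using assms by (simp add: s_def)
  have "(p has_integral integral {0..s} p) {0 + T..s + T}"
    by (intro periodic_has_integral_shift[where p = p and T = T, OF per] integrable_integral periodic_integrable[OF assms(1-3)])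
  then have "integral {T..s + T} p = integral {0..s} p"
    by (simp add: integral_unique)
  moreover have "integral {0..T} p + integral {T..s + T} p = integral {0..s + T} p"
    using \<open>0 < T\<close> \<open>0 \<le> s\<close>
    by (intro Henstock_Kurzweil_Integration.integral_combine periodic_integrable[OF assms(1-3)]) auto
  moreover have "real (Suc N) * T + t = s + T" by (simp add: s_def algebra_simps)
  ultimately show ?case
    using Suc.IH by (simp add: s_def algebra_simps)
qed simp

section \<open>The forward equation of the chain\<close>

lemma has_real_derivative_one_sided_quotients:
  fixes f :: "real \<Rightarrow> real"
  assumes "((\<lambda>h. (f (t + h) - f t) / h) \<longlongrightarrow> D) (at_right 0)"
    and "((\<lambda>h. (f t - f (t - h)) / h) \<longlongrightarrow> D) (at_right 0)"
  shows "(f has_real_derivative D) (at t)"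
proof -
  have "(f (t - h) - f t) / - h = (f t - f (t - h)) / h" for h
    by (metis minus_diff_eq minus_divide_divide)
  then show ?thesis
    using assms by (simp add: DERIV_def filterlim_at_split filterlim_at_left_to_right)
qed

context two_state_chain
begin

lemma state_event [measurable]:
  "0 \<le> t \<Longrightarrow> {\<omega> \<in> space M. Y t \<omega> = y} \<in> sets M"
proof -
  assume "0 \<le> t"
  have "Y t -` ({-1, 1} \<inter> {y}) \<inter> space M \<in> sets M"
    by (rule measurable_sets[OF state[OF \<open>0 \<le> t\<close>]]) auto
  also have "Y t -` ({-1, 1} \<inter> {y}) \<inter> space M = {\<omega> \<in> space M. Y t \<omega> = y}"
    using measurable_space[OF state[OF \<open>0 \<le> t\<close>]] by auto
  finally show ?thesis .
qed

lemma state_cases: "0 \<le> t \<Longrightarrow> \<omega> \<in> space M \<Longrightarrow> Y t \<omega> = -1 \<or> Y t \<omega> = 1"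
  using measurable_space[OF state] by auto

lemma state_prob_sum:
  assumes "0 \<le> t"
  shows "state_prob M Y (-1) t + state_prob M Y 1 t = 1"
proof -
  have "state_prob M Y (-1) t + state_prob M Y 1 t =
      prob ({\<omega> \<in> space M. Y t \<omega> = -1} \<union> {\<omega> \<in> space M. Y t \<omega> = 1})"
    unfolding state_prob_def using assms by (intro finite_measure_Union[symmetric]) auto
  also have "{\<omega> \<in> space M. Y t \<omega> = -1} \<union> {\<omega> \<in> space M. Y t \<omega> = 1} = space M"
    using state_cases[OF assms] by auto
  finally show ?thesis by (simp add: prob_space)
qed

lemma state_prob_split:
  assumes "0 \<le> s" "0 \<le> u" "y \<in> {-1, 1}"
  shows "state_prob M Y y s =
    \<P>(\<omega> in M. Y s \<omega> = y \<and> Y u \<omega> = y) + \<P>(\<omega> in M. Y s \<omega> = y \<and> Y u \<omega> = - y)"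
proof -
  have ev: "{\<omega> \<in> space M. Y s \<omega> = y \<and> Y u \<omega> = z} \<in> sets M" for z
  proof -
    have "{\<omega> \<in> space M. Y s \<omega> = y \<and> Y u \<omega> = z} =
        {\<omega> \<in> space M. Y s \<omega> = y} \<inter> {\<omega> \<in> space M. Y u \<omega> = z}" by auto
    then show ?thesis using assms by (simp add: state_event)
  qed
  have "{\<omega> \<in> space M. Y s \<omega> = y} =
      {\<omega> \<in> space M. Y s \<omega> = y \<and> Y u \<omega> = y} \<union> {\<omega> \<in> space M. Y s \<omega> = y \<and> Y u \<omega> = - y}"
    using state_cases[OF assms(2)] assms(3) by fastforce
  then show ?thesis
    unfolding state_prob_def using assms(3) ev
    by (auto simp: disjoint_iff intro!: finite_measure_Union)
qed

text \<open>
  The paths in state \<open>y\<close> at both times cancel; what remains is the flow into \<open>y\<close> minus the flow out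
  of \<open>y\<close>.
\<close>

lemma state_prob_balance:
  assumes "0 \<le> s" "0 \<le> u" "y \<in> {-1, 1}"
  shows "state_prob M Y y u - state_prob M Y y s =
    \<P>(\<omega> in M. Y s \<omega> = - y \<and> Y u \<omega> = y) - \<P>(\<omega> in M. Y s \<omega> = y \<and> Y u \<omega> = - y)"
  using state_prob_split[OF assms] state_prob_split[OF assms(2,1,3)]
  by (simp add: conj_commute)

lemma state_prob_continuous:
  assumes "y \<in> {-1, 1}"
  shows "continuous_on {0..} (state_prob M Y y)"
  unfolding continuous_on_def
proof
  fix t :: real assume "t \<in> {0..}"
  then have t: "0 \<le> t" by simp
  have "\<bar>state_prob M Y y s - state_prob M Y y t\<bar> \<le> \<P>(\<omega> in M. Y s \<omega> \<noteq> Y t \<omega>)" if s: "0 \<le> s" for s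
  proof -
    let ?N = "{\<omega> \<in> space M. Y s \<omega> \<noteq> Y t \<omega>}"
    have "?N = space M - (({\<omega> \<in> space M. Y s \<omega> = -1} \<inter> {\<omega> \<in> space M. Y t \<omega> = -1}) \<union>
        ({\<omega> \<in> space M. Y s \<omega> = 1} \<inter> {\<omega> \<in> space M. Y t \<omega> = 1}))"
    proof (rule set_eqI)
      fix \<omega>
      show "\<omega> \<in> ?N \<longleftrightarrow> \<omega> \<in> space M - (({\<omega> \<in> space M. Y s \<omega> = -1} \<inter> {\<omega> \<in> space M. Y t \<omega> = -1}) \<union>
          ({\<omega> \<in> space M. Y s \<omega> = 1} \<inter> {\<omega> \<in> space M. Y t \<omega> = 1}))"
        using state_cases[OF s, of \<omega>] state_cases[OF t, of \<omega>] by auto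
    qed
    also have "\<dots> \<in> sets M"
      using s t by (intro sets.Diff sets.Un sets.Int sets.top state_event)
    finally have N: "?N \<in> sets M" .
    have "\<P>(\<omega> in M. Y t \<omega> = - y \<and> Y s \<omega> = y) \<le> prob ?N"
      using assms by (intro finite_measure_mono N) auto
    moreover have "\<P>(\<omega> in M. Y t \<omega> = y \<and> Y s \<omega> = - y) \<le> prob ?N"
      using assms by (intro finite_measure_mono N) auto
    ultimately show ?thesis
      unfolding state_prob_balance[OF t s assms]
      using measure_nonneg[of M] by (smt (verit))
  qed
  then have "\<forall>\<^sub>F s in at t within {0..}.
      norm (state_prob M Y y s - state_prob M Y y t) \<le> \<P>(\<omega> in M. Y s \<omega> \<noteq> Y t \<omega>)"
    by (auto simp: eventually_at_filter intro!: always_eventually)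
  then have "((\<lambda>s. state_prob M Y y s - state_prob M Y y t) \<longlongrightarrow> 0) (at t within {0..})"
    using continuous_in_prob[OF t] by (rule Lim_null_comparison)
  then show "(state_prob M Y y \<longlongrightarrow> state_prob M Y y t) (at t within {0..})"
    by (rule LIM_zero_cancel)
qed

text \<open>
  Both one-sided rate conditions weight the rate with the state probability at the same time \<open>t\<close>,
  so that the two one-sided derivatives agree.
\<close>

lemma state_prob_derivative:
  "\<exists>C. countable C \<and> (\<forall>t\<in>{0<..} - C. \<forall>y\<in>{-1, 1}.
    (state_prob M Y y has_real_derivative
      p t * (state_prob M Y (- y) t - state_prob M Y y t)) (at t))"
proof -
  obtain C where "countable C" and
    rate: "\<And>t y. t \<in> {0<..} - C \<Longrightarrow> y \<in> {-1, 1} \<Longrightarrow>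
      ((\<lambda>h. \<P>(\<omega> in M. Y t \<omega> = y \<and> Y (t + h) \<omega> = - y) / h)
          \<longlongrightarrow> p t * state_prob M Y y t) (at_right 0) \<and>
      ((\<lambda>h. \<P>(\<omega> in M. Y (t - h) \<omega> = y \<and> Y t \<omega> = - y) / h)
          \<longlongrightarrow> p t * state_prob M Y y t) (at_right 0)"
    using jump_rate unfolding state_prob_def by fastforce
  have "(state_prob M Y y has_real_derivative
      p t * (state_prob M Y (- y) t - state_prob M Y y t)) (at t)"
    if t: "t \<in> {0<..} - C" and y: "y \<in> {-1, 1}" for t y
  proof (rule has_real_derivative_one_sided_quotients)
    have y': "- y \<in> {-1, 1}" using y by auto
    have D: "p t * (state_prob M Y (- y) t - state_prob M Y y t) =
        p t * state_prob M Y (- y) t - p t * state_prob M Y y t"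
      by (simp add: algebra_simps)
    have "((\<lambda>h. \<P>(\<omega> in M. Y t \<omega> = - y \<and> Y (t + h) \<omega> = y) / h
          - \<P>(\<omega> in M. Y t \<omega> = y \<and> Y (t + h) \<omega> = - y) / h)
        \<longlongrightarrow> p t * state_prob M Y (- y) t - p t * state_prob M Y y t) (at_right 0)"
      using rate[OF t y'] rate[OF t y] by (intro tendsto_diff) auto
    moreover have "\<forall>\<^sub>F h in at_right 0.
        \<P>(\<omega> in M. Y t \<omega> = - y \<and> Y (t + h) \<omega> = y) / h
          - \<P>(\<omega> in M. Y t \<omega> = y \<and> Y (t + h) \<omega> = - y) / h
        = (state_prob M Y y (t + h) - state_prob M Y y t) / h"
      using eventually_at_right_less[of 0]
    proof eventually_elim
      case (elim h)
      then show ?case using state_prob_balance[of t "t + h" y] t y by (simp add: diff_divide_distrib)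
    qed
    ultimately show "((\<lambda>h. (state_prob M Y y (t + h) - state_prob M Y y t) / h)
        \<longlongrightarrow> p t * (state_prob M Y (- y) t - state_prob M Y y t)) (at_right 0)"
      unfolding D by (rule Lim_transform_eventually)
    have "((\<lambda>h. \<P>(\<omega> in M. Y (t - h) \<omega> = - y \<and> Y t \<omega> = y) / h
          - \<P>(\<omega> in M. Y (t - h) \<omega> = y \<and> Y t \<omega> = - y) / h)
        \<longlongrightarrow> p t * state_prob M Y (- y) t - p t * state_prob M Y y t) (at_right 0)"
      using rate[OF t y'] rate[OF t y] by (intro tendsto_diff) auto
    moreover have "\<forall>\<^sub>F h in at_right 0.
        \<P>(\<omega> in M. Y (t - h) \<omega> = - y \<and> Y t \<omega> = y) / h
          - \<P>(\<omega> in M. Y (t - h) \<omega> = y \<and> Y t \<omega> = - y) / h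
        = (state_prob M Y y t - state_prob M Y y (t - h)) / h"
    proof -
      have "\<forall>\<^sub>F h in at_right 0. h < t"
        using t by (intro eventually_at_right_real[THEN eventually_mono]) auto
      then show ?thesis
      proof eventually_elim
        case (elim h)
        then show ?case using state_prob_balance[of "t - h" t y] t y by (simp add: diff_divide_distrib)
      qed
    qed
    ultimately show "((\<lambda>h. (state_prob M Y y t - state_prob M Y y (t - h)) / h)
        \<longlongrightarrow> p t * (state_prob M Y (- y) t - state_prob M Y y t)) (at_right 0)"
      unfolding D by (rule Lim_transform_eventually)
  qed
  with \<open>countable C\<close> show ?thesis by blast
qed

theorem state_prob_difference:
  assumes "0 \<le> t" "p integrable_on {0..t}"
  shows "state_prob M Y 1 t - state_prob M Y (-1) t =
    (state_prob M Y 1 0 - state_prob M Y (-1) 0) * exp (- 2 * integral {0..t} p)"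
proof -
  obtain C where "countable C" and deriv: "\<forall>s\<in>{0<..} - C. \<forall>y\<in>{-1, 1}.
      (state_prob M Y y has_real_derivative
        p s * (state_prob M Y (- y) s - state_prob M Y y s)) (at s)"
    using state_prob_derivative by (elim exE conjE)
  have "state_prob M Y 1 t - state_prob M Y (-1) t =
      (state_prob M Y 1 0 - state_prob M Y (-1) 0) * exp (integral {0..t} (\<lambda>s. - 2 * p s))"
  proof (rule linear_ode_solution[OF \<open>countable C\<close> assms(1)])
    show "continuous_on {0..t} (\<lambda>s. state_prob M Y 1 s - state_prob M Y (-1) s)"
      by (intro continuous_on_diff continuous_on_subset[OF state_prob_continuous]) auto
    show "(\<lambda>s. - 2 * p s) integrable_on {0..t}"
      using assms(2) by (rule integrable_on_mult_right)
    fix s assume "s \<in> {0<..<t} - C"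
    then have s: "s \<in> {0<..} - C" by auto
    show "((\<lambda>s. state_prob M Y 1 s - state_prob M Y (-1) s) has_real_derivative
        - 2 * p s * (state_prob M Y 1 s - state_prob M Y (-1) s)) (at s)"
      using DERIV_diff[OF deriv[rule_format, OF s, of 1] deriv[rule_format, OF s, of "-1"]] by (simp add: algebra_simps)
  qed
  then show ?thesis by (simp only: integral_mult_right)
qed

end

section \<open>State probabilities and invariant measure\<close>

theorem corollary3p10:
  fixes M :: "'a measure" and Y :: "real \<Rightarrow> 'a \<Rightarrow> int" and p :: "real \<Rightarrow> real" and T t :: real
  assumes "0 < T"
    and "\<And>s. p (s + T) = p s"
    and "p integrable_on {0..T}"
    and "0 < integral {0..T} p"
    and "two_state_chain M Y p"
    and "0 \<le> t"
  shows "state_prob M Y (-1) t =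
           1 / 2 - (state_prob M Y 1 0 - state_prob M Y (-1) 0) / 2 * exp (- 2 * integral {0..t} p)
       \<and> state_prob M Y 1 t =
           1 / 2 + (state_prob M Y 1 0 - state_prob M Y (-1) 0) / 2 * exp (- 2 * integral {0..t} p)
       \<and> convergent (\<lambda>N. state_vec M Y (real N * T + t))
       \<and> invariant_measure M Y T t = (1 / 2) *\<^sub>R vector [1, 1]"
proof -
  interpret two_state_chain M Y p by fact
  define \<Delta> where "\<Delta> = state_prob M Y 1 0 - state_prob M Y (-1) 0"
  define I where "I = integral {0..T} p"
  have "0 < I" using assms(4) by (simp add: I_def)
  have sol: "state_prob M Y (-1) s = 1 / 2 - \<Delta> / 2 * exp (- 2 * integral {0..s} p)"
    "state_prob M Y 1 s = 1 / 2 + \<Delta> / 2 * exp (- 2 * integral {0..s} p)" if "0 \<le> s" for s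
    using state_prob_difference[OF that periodic_integrable[OF assms(1-3)]] state_prob_sum[OF that]
    unfolding \<Delta>_def by (simp_all add: field_simps)
  have "(\<lambda>N. exp (- 2 * integral {0..t} p) * exp (- 2 * I) ^ N) \<longlonglongrightarrow> exp (- 2 * integral {0..t} p) * 0"
    using \<open>0 < I\<close> by (intro tendsto_mult_left LIMSEQ_realpow_zero) auto
  moreover have "exp (- 2 * integral {0..real N * T + t} p) =
      exp (- 2 * integral {0..t} p) * exp (- 2 * I) ^ N" for N
    unfolding periodic_integral_add_periods[OF assms(1-3) \<open>0 \<le> t\<close>] I_def
    by (simp add: algebra_simps flip: exp_of_nat_mult exp_add)
  ultimately have decay: "(\<lambda>N. exp (- 2 * integral {0..real N * T + t} p)) \<longlonglongrightarrow> 0"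
    by simp
  have nonneg: "0 \<le> real N * T + t" for N using assms by simp
  have minus: "(\<lambda>N. state_prob M Y (-1) (real N * T + t)) \<longlonglongrightarrow> 1 / 2 - \<Delta> / 2 * 0"
    unfolding sol(1)[OF nonneg] by (intro tendsto_intros decay)
  have plus: "(\<lambda>N. state_prob M Y 1 (real N * T + t)) \<longlonglongrightarrow> 1 / 2 + \<Delta> / 2 * 0"
    unfolding sol(2)[OF nonneg] by (intro tendsto_intros decay)
  have lim: "(\<lambda>N. state_vec M Y (real N * T + t)) \<longlonglongrightarrow> (1 / 2) *\<^sub>R vector [1, 1]"
  proof (intro vec_tendstoI)
    fix i :: 2
    show "(\<lambda>N. state_vec M Y (real N * T + t) $ i) \<longlonglongrightarrow> ((1 / 2) *\<^sub>R vector [1, 1]) $ i"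
      using exhaust_2[of i] minus plus by (auto simp: state_vec_def)
  qed
  from lim have "convergent (\<lambda>N. state_vec M Y (real N * T + t))"
    by (rule convergentI)
  moreover from lim have "invariant_measure M Y T t = (1 / 2) *\<^sub>R vector [1, 1]"
    unfolding invariant_measure_def by (rule limI)
  ultimately show ?thesis
    using sol[OF \<open>0 \<le> t\<close>] unfolding \<Delta>_def by blast
qed

end
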